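(* Let $\mathbf{Z}\in\mathbb{R}^{M\times M}$ be the impedance coupling matrix of the uniform linear array described in the context, let $R_{\rm rad}$ be the radiation resistance of each antenna, and let $\mathbf{h}_u\in\mathbb{C}^{M}$, $\mathbf{h}_u\neq\mathbf{0}$, be the (multipath) channel vector of user $u$. The power gain that user $u$ obtains with precoding vector $\mathbf{w}\in\mathbb{C}^M\setminus\{\mathbf{0}\}$ is $$D_u(\mathbf{w})=\frac{\mathbf{w}^T\mathbf{h}_u\mathbf{h}_u^H\mathbf{w}^*}{\mathbf{w}^T\mathbf{Z}\mathbf{w}^*}.$$ The precoding vector that maximizes the power gain $D_u$ for user $u$ is given by $$\mathbf{w}_u^{\rm SP}=\gamma_u\,\mathbf{Z}^{-1}\mathbf{h}_u^*,$$ where $\gamma_u$ is the power control coefficient. For a given radiation power $\rho_u$, $\gamma_u$ is determined by $$\gamma_u=\sqrt{\frac{2\rho_u}{\mathbf{h}_u^H\,(R_{\rm rad}\mathbf{Z})^{-1}\,\mathbf{h}_u}}.$$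
   Context: Notation: $(\cdot)^*$, $(\cdot)^T$, $(\cdot)^H$ denote entrywise complex conjugate, transpose, and conjugate transpose. The array consists of $M$ isotropic antennas placed on a line with uniform spacing $d$, $0<d<\lambda/2$, where $\lambda$ is the wavelength and $k=2\pi/\lambda$. Its impedance coupling matrix $\mathbf{Z}=(z_{mn})\in\mathbb{R}^{M\times M}$ has entries $z_{mm}=1$ and $z_{mn}=\frac{\sin[kd(n-m)]}{kd(n-m)}$ for $n\ne m$. The channel of user $u$ is $\mathbf{h}_u=\frac1P\sum_{p=1}^P\alpha_{up}\,\mathbf{e}(\phi_{up})$, where $P$ is an arbitrary number of paths, $\alpha_{up}\in\mathbb{C}$ is the complex gain of path $p$, and $\mathbf{e}(\phi)=[1,e^{-j2\pi\frac{d}{\lambda}\cos\phi},\dots,e^{-j2\pi\frac{(M-1)d}{\lambda}\cos\phi}]^T$ is the steering vector at azimuth angle $\phi$ ($j$ is the imaginary unit). The power radiated by the array with precoding vector $\mathbf{w}_u^{\rm SP}$ is $P_{\rm rad}=\frac12(\mathbf{w}_u^{\rm SP})^T(R_{\rm rad}\mathbf{Z})(\mathbf{w}_u^{\rm SP})^*$.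
   Formalization: As printed, γ_u gives radiated power R_rad²ρ_u, not ρ_u, unless R_rad = 1 or ρ_u = 0; instead it is proved that the printed γ_u goes with (R_rad Z)^{-1}h_u^*, and γ_u/R_rad with Z^{-1}h_u^*. *)

theory Defs
  imports Complex_Main "Jordan_Normal_Form.Conjugate" "Jordan_Normal_Form.Gauss_Jordan_Elimination"
begin

text \<open>
  Antennas are numbered from 0 to M - 1, so that entry m of the steering vector carries the
  phase of antenna m.  The wavelength is lam.
\<close>

definition wavenumber :: "real \<Rightarrow> real" where
  "wavenumber lam = 2 * pi / lam"

definition impedance_mat :: "nat \<Rightarrow> real \<Rightarrow> real \<Rightarrow> real mat" where
  "impedance_mat M d lam = mat M M (\<lambda>(m, n).
     if m = n then 1
     else sin (wavenumber lam * d * (real n - real m)) / (wavenumber lam * d * (real n - real m)))"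

definition steering_vec :: "nat \<Rightarrow> real \<Rightarrow> real \<Rightarrow> real \<Rightarrow> complex vec" where
  "steering_vec M d lam \<phi> = vec M (\<lambda>m.
     exp (- (\<i> * complex_of_real (2 * pi * (real m * d / lam) * cos \<phi>))))"

definition channel_vec ::
  "nat \<Rightarrow> real \<Rightarrow> real \<Rightarrow> nat \<Rightarrow> (nat \<Rightarrow> complex) \<Rightarrow> (nat \<Rightarrow> real) \<Rightarrow> complex vec" where
  "channel_vec M d lam P \<alpha> \<phi> = vec M (\<lambda>m.
     1 / of_nat P * (\<Sum>p = 1..P. \<alpha> p * steering_vec M d lam (\<phi> p) $ m))"

abbreviation cmat :: "real mat \<Rightarrow> complex mat" where
  "cmat \<equiv> map_mat complex_of_real"

text \<open>The inverse is only meaningful for an invertible square matrix.\<close>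

definition mat_inv :: "'a :: field mat \<Rightarrow> 'a mat" where
  "mat_inv A = the (mat_inverse A)"

text \<open>
  The product \<^term>\<open>(\<bullet>)\<close> is bilinear (no conjugation), so \<^term>\<open>x \<bullet> y\<close> is the transpose
  of x times y, and conjugations are written explicitly.  The gain and the radiated power are
  kept as complex numbers, exactly as the formulas read, instead of taking real parts.
\<close>

definition power_gain :: "real mat \<Rightarrow> complex vec \<Rightarrow> complex vec \<Rightarrow> complex" where
  "power_gain Z h w =
     ((w \<bullet> h) * (conjugate h \<bullet> conjugate w)) / (w \<bullet> (cmat Z *\<^sub>v conjugate w))"

definition radiated_power :: "real \<Rightarrow> real mat \<Rightarrow> complex vec \<Rightarrow> complex" where
  "radiated_power R Z w = 1 / 2 * (w \<bullet> (cmat (R \<cdot>\<^sub>m Z) *\<^sub>v conjugate w))"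

text \<open>
  The order on complex numbers used below is the one of \<^theory>\<open>HOL-Library.Complex_Order\<close>:
  a comparison of real parts together with equality of imaginary parts.  A maximizer is thus a
  greatest element, not merely one that is maximal for a partial order.
\<close>

definition maximizes_power_gain :: "nat \<Rightarrow> real mat \<Rightarrow> complex vec \<Rightarrow> complex vec \<Rightarrow> bool" where
  "maximizes_power_gain M Z h w \<longleftrightarrow>
     w \<in> carrier_vec M \<and> w \<noteq> 0\<^sub>v M \<and>
     (\<forall>v \<in> carrier_vec M. v \<noteq> 0\<^sub>v M \<longrightarrow> power_gain Z h v \<le> power_gain Z h w)"

definition sp_precoder :: "real mat \<Rightarrow> complex vec \<Rightarrow> complex \<Rightarrow> complex vec" where
  "sp_precoder Z h \<gamma> = \<gamma> \<cdot>\<^sub>v (cmat (mat_inv Z) *\<^sub>v conjugate h)"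

text \<open>
  Normalisation: with this coefficient c, the vector c (R Z)^(-1) h^* radiates the power
  \<rho>.  As (R Z)^(-1) = (1/R) Z^(-1), the coefficient to be put in front of
  Z^(-1) h^* is c / R; the two coincide exactly when R = 1 or \<rho> = 0.
\<close>

definition power_coeff :: "real \<Rightarrow> real mat \<Rightarrow> complex vec \<Rightarrow> real \<Rightarrow> complex" where
  "power_coeff R Z h \<rho> =
     csqrt (2 * complex_of_real \<rho> / (conjugate h \<bullet> (cmat (mat_inv (R \<cdot>\<^sub>m Z)) *\<^sub>v h)))"

end

theory Submission
  imports Defs "Jordan_Normal_Form.Determinant"
begin

text \<open>
  With $a = k d$, each entry $z_{mn}$ is the mean of $e^{j a (m - n) t}$ over $t \in [-1, 1]$, so
  $w^T Z w^*$ is the mean of $|\sum_m w_m e^{j a m t}|^2$.  As $0 < a < \pi$, the points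
  $e^{j a t}$, $0 < t < 1$, are pairwise distinct, and a nonzero polynomial cannot vanish at all
  of them; hence $Z$ is positive definite.  In the inner product
  $\langle v, w \rangle = v^T Z w^*$ the vector $g = Z^{-1} h^*$ represents $v \mapsto v^T h$, so
  the gain of $w$ is $|\langle w, g \rangle|^2 / \langle w, w \rangle$, and the Cauchy--Schwarz
  inequality with its equality case gives the maximizers.
\<close>

section \<open>Hermitian forms of real symmetric matrices\<close>

text \<open>The conjugate sits on the second argument, so the form is linear in \<open>v\<close> and
  antilinear in \<open>w\<close>, and \<open>hform Z w w\<close> is the denominator of the power
  gain.\<close>

definition hform :: "real mat \<Rightarrow> complex vec \<Rightarrow> complex vec \<Rightarrow> complex" where
  "hform A v w = v \<bullet> (cmat A *\<^sub>v conjugate w)"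

lemma hform_sum:
  assumes "A \<in> carrier_mat n n" "v \<in> carrier_vec n" "w \<in> carrier_vec n"
  shows "hform A v w = (\<Sum>i<n. \<Sum>j<n. v $ i * (of_real (A $$ (i, j)) * cnj (w $ j)))"
  using assms unfolding hform_def scalar_prod_def
  by (auto simp: scalar_prod_def sum_distrib_left atLeast0LessThan intro!: sum.cong)

text \<open>Keeps the optimisation apart from the array: the impedance matrix enters it only through
  symmetry and positivity. Symmetry makes \<open>hform A w w\<close> real, so \<open>Re\<close>
  discards nothing.\<close>

locale posdef_mat =
  fixes n :: nat and A :: "real mat"
  assumes carrier: "A \<in> carrier_mat n n"
    and sym: "transpose_mat A = A"
    and pos: "\<And>w. w \<in> carrier_vec n \<Longrightarrow> w \<noteq> 0\<^sub>v n \<Longrightarrow> 0 < Re (hform A w w)"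
begin

lemma cmat_carrier: "cmat A \<in> carrier_mat n n"
  using carrier by auto

lemma hform_cnj:
  assumes "v \<in> carrier_vec n" "w \<in> carrier_vec n"
  shows "cnj (hform A v w) = hform A w v"
proof -
  have A: "A $$ (i, j) = A $$ (j, i)" if "i < n" "j < n" for i j
    using arg_cong[OF sym, of "\<lambda>B. B $$ (i, j)"] carrier that by auto
  have "cnj (hform A v w) = (\<Sum>i<n. \<Sum>j<n. w $ j * (of_real (A $$ (j, i)) * cnj (v $ i)))"
    unfolding hform_sum[OF carrier assms]
    by (auto simp: A intro!: sum.cong)
  also have "\<dots> = hform A w v"
    unfolding hform_sum[OF carrier assms(2,1)] by (rule sum.swap)
  finally show ?thesis .
qed

lemma hform_diff_smult:
  assumes "u \<in> carrier_vec n" "v \<in> carrier_vec n" "w \<in> carrier_vec n"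
  shows "hform A (u - c \<cdot>\<^sub>v v) w = hform A u w - c * hform A v w"
  using assms by (simp add: hform_sum[OF carrier] left_diff_distrib sum_subtractf
      sum_distrib_left mult.assoc)

lemma hform_smult:
  assumes "v \<in> carrier_vec n" "w \<in> carrier_vec n"
  shows "hform A (c \<cdot>\<^sub>v v) w = c * hform A v w"
  using assms by (simp add: hform_sum[OF carrier] sum_distrib_left mult.assoc)

lemma hform_smult_right:
  assumes "v \<in> carrier_vec n" "w \<in> carrier_vec n"
  shows "hform A v (c \<cdot>\<^sub>v w) = cnj c * hform A v w"
proof -
  have "hform A v (c \<cdot>\<^sub>v w) = cnj (hform A (c \<cdot>\<^sub>v w) v)"
    using assms by (simp add: hform_cnj)
  then show ?thesis
    using assms by (simp add: hform_smult hform_cnj)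
qed

lemma hform_self: "w \<in> carrier_vec n \<Longrightarrow> hform A w w = of_real (Re (hform A w w))"
  by (metis Reals_cnj_iff hform_cnj of_real_Re)

lemma hform_nonzero: "w \<in> carrier_vec n \<Longrightarrow> w \<noteq> 0\<^sub>v n \<Longrightarrow> hform A w w \<noteq> 0"
  using pos by fastforce

section \<open>Orthogonal projection and the Cauchy-Schwarz inequality\<close>

text \<open>Pythagoras: \<open>r\<close> is what remains of \<open>v\<close> after orthogonal
  projection onto \<open>w\<close>.\<close>

lemma hform_defect:
  assumes v: "v \<in> carrier_vec n" and w: "w \<in> carrier_vec n" "w \<noteq> 0\<^sub>v n"
  defines "r \<equiv> v - (hform A v w / hform A w w) \<cdot>\<^sub>v w"
  shows "Re (hform A r r) = Re (hform A v v) - (cmod (hform A v w))\<^sup>2 / Re (hform A w w)"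
proof -
  let ?c = "hform A v w / hform A w w"
  note nz = hform_nonzero[OF w]
  have r: "r \<in> carrier_vec n" using v w by (simp add: r_def)
  have 0: "hform A r w = 0"
    using v w nz by (simp add: r_def hform_diff_smult)
  have "hform A w r = 0"
    using hform_cnj[OF r w(1)] 0 by simp
  \<comment> \<open>Only the first \<open>r\<close> is expanded; its component along
    \<open>w\<close> contributes nothing, because \<open>r\<close> is orthogonal to
    \<open>w\<close>.\<close>
  then have "hform A r r = hform A v r"
    unfolding r_def using v w r by (subst hform_diff_smult) (auto simp: r_def)
  also have "\<dots> = cnj (hform A r v)"
    using hform_cnj v r by simp
  also have "hform A r v = hform A v v - ?c * cnj (hform A v w)"
    using v w by (simp add: r_def hform_diff_smult hform_cnj)
  also have "?c * cnj (hform A v w) = of_real ((cmod (hform A v w))\<^sup>2 / Re (hform A w w))"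
    unfolding of_real_divide complex_norm_square hform_self[OF w(1), symmetric] by simp
  finally show ?thesis by simp
qed

text \<open>The gap between the two sides is a positive multiple of the form at the residual
  \<open>r\<close>; if it vanishes, then \<open>r\<close> is zero. The inequality is divided by the
  form at \<open>v\<close> so that its left side has the shape of a power gain.\<close>

lemma hform_Cauchy_Schwarz:
  assumes v: "v \<in> carrier_vec n" "v \<noteq> 0\<^sub>v n" and w: "w \<in> carrier_vec n" "w \<noteq> 0\<^sub>v n"
  shows "(cmod (hform A v w))\<^sup>2 / Re (hform A v v) \<le> Re (hform A w w)" (is ?le)
    and "(cmod (hform A v w))\<^sup>2 / Re (hform A v v) = Re (hform A w w) \<Longrightarrow> \<exists>c. v = c \<cdot>\<^sub>v w"
proof -
  let ?c = "hform A v w / hform A w w"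
  define r where "r = v - ?c \<cdot>\<^sub>v w"
  have r: "r \<in> carrier_vec n" using v w by (simp add: r_def)
  note defect = hform_defect[OF v(1) w, folded r_def]
  have ge: "0 \<le> Re (hform A r r)"
  proof (cases "r = 0\<^sub>v n")
    case True
    then show ?thesis by (simp add: hform_sum[OF carrier])
  next
    case False
    then show ?thesis using pos r by (simp add: less_imp_le)
  qed
  show ?le
    using ge defect pos[OF v] pos[OF w] by (simp add: field_simps)
  assume "(cmod (hform A v w))\<^sup>2 / Re (hform A v v) = Re (hform A w w)"
  then have "Re (hform A r r) = 0"
    using defect pos[OF v] pos[OF w] by (simp add: field_simps)
  then have "r = 0\<^sub>v n" using pos r by force
  then have "v = ?c \<cdot>\<^sub>v w"
    using v w unfolding r_def
    by (intro eq_vecI) (auto dest!: arg_cong[where f = "\<lambda>x. x $ _"] simp: vec_eq_iff)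
  then show "\<exists>c. v = c \<cdot>\<^sub>v w" ..
qed

section \<open>Invertibility\<close>

text \<open>A real kernel vector, read as a complex one, is fixed by conjugation and would make the
  form vanish at a nonzero vector.\<close>

lemma det_nonzero: "det A \<noteq> 0"
proof
  assume "det A = 0"
  then obtain v where v: "v \<in> carrier_vec n" "v \<noteq> 0\<^sub>v n" "A *\<^sub>v v = 0\<^sub>v n"
    using det_0_iff_vec_prod_zero[OF carrier] by blast
  let ?v = "map_vec complex_of_real v"
  have "cmat A *\<^sub>v conjugate ?v = 0\<^sub>v n"
  proof (rule eq_vecI)
    fix i assume i: "i < dim_vec (0\<^sub>v n)"
    have "(cmat A *\<^sub>v conjugate ?v) $ i = of_real ((A *\<^sub>v v) $ i)"
      using i v(1) carrier by (auto simp: scalar_prod_def intro!: sum.cong)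
    then show "(cmat A *\<^sub>v conjugate ?v) $ i = 0\<^sub>v n $ i" using v i by simp
  qed (use carrier in auto)
  then have "hform A ?v ?v = 0" using v by (simp add: hform_def)
  moreover have "?v \<noteq> 0\<^sub>v n" using v by (auto simp: vec_eq_iff)
  ultimately show False using hform_nonzero[of ?v] v by simp
qed

text \<open>With a nonzero determinant \<open>mat_inverse\<close> returns \<open>Some\<close>, so
  the \<open>the\<close> inside \<open>mat_inv\<close> yields a genuine inverse.\<close>

lemma mat_inv:
  shows mat_inv_carrier: "mat_inv A \<in> carrier_mat n n"
    and mult_mat_inv: "A * mat_inv A = 1\<^sub>m n"
    and mat_inv_mult: "mat_inv A * A = 1\<^sub>m n"
proof -
  have "A \<in> Units (ring_mat TYPE(real) n ())"
    using det_non_zero_imp_unit[OF carrier det_nonzero] .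
  then obtain B where "mat_inverse A = Some B"
    using mat_inverse(1)[OF carrier, of "()"] by (cases "mat_inverse A") auto
  with mat_inverse(2)[OF carrier this]
  show "mat_inv A \<in> carrier_mat n n" "A * mat_inv A = 1\<^sub>m n" "mat_inv A * A = 1\<^sub>m n"
    by (auto simp: mat_inv_def)
qed

lemma invertible: "invertible_mat A"
  unfolding invertible_mat_def inverts_mat_def
  using carrier mat_inv by (auto intro!: exI[of _ "mat_inv A"])

lemma cmat_mult_inv_vec:
  assumes "x \<in> carrier_vec n"
  shows "cmat A *\<^sub>v (cmat (mat_inv A) *\<^sub>v x) = x"
proof -
  have "cmat A * cmat (mat_inv A) = cmat (A * mat_inv A)"
    using carrier mat_inv_carrier by (intro eq_matI) (auto simp: scalar_prod_def)
  also have "\<dots> = 1\<^sub>m n"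
    by (auto simp: mult_mat_inv)
  finally show ?thesis
    using assms assoc_mult_mat_vec[OF cmat_carrier, of "cmat (mat_inv A)" n x] mat_inv_carrier
    by simp
qed

lemma conjugate_mat_inv:
  assumes "h \<in> carrier_vec n"
  shows "conjugate (cmat (mat_inv A) *\<^sub>v conjugate h) = cmat (mat_inv A) *\<^sub>v h"
  using assms mat_inv_carrier
  by (intro eq_vecI) (auto simp: scalar_prod_def intro!: sum.cong)

section \<open>The precoder as a Riesz representative\<close>

context
  fixes h :: "complex vec"
  assumes h: "h \<in> carrier_vec n" "h \<noteq> 0\<^sub>v n"
begin

definition riesz :: "complex vec" where
  "riesz = cmat (mat_inv A) *\<^sub>v conjugate h"

lemma riesz_carrier: "riesz \<in> carrier_vec n"
  using mat_inv_carrier h by (auto simp: riesz_def)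

text \<open>As \<open>mat_inv A\<close> is real, conjugating \<open>riesz\<close> gives the inverse
  applied to \<open>h\<close>, and \<open>A\<close> cancels it.\<close>

lemma hform_riesz: "hform A v riesz = v \<bullet> h"
  using h by (simp add: hform_def riesz_def conjugate_mat_inv cmat_mult_inv_vec)

lemma riesz_nonzero: "riesz \<noteq> 0\<^sub>v n"
proof
  assume "riesz = 0\<^sub>v n"
  moreover have "cmat A *\<^sub>v riesz = conjugate h"
    using h by (simp add: riesz_def cmat_mult_inv_vec)
  moreover have "cmat A *\<^sub>v 0\<^sub>v n = 0\<^sub>v n"
    using carrier by (intro eq_vecI) auto
  ultimately have "conjugate h = 0\<^sub>v n" by simp
  then show False using h by simp
qed

text \<open>Identifies the squared norm of the representative with the expression that occurs, for
  the scaled matrix, in \<open>power_coeff\<close>.\<close>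

lemma hform_riesz_self: "hform A riesz riesz = conjugate h \<bullet> (cmat (mat_inv A) *\<^sub>v h)"
proof -
  have "hform A riesz riesz = cnj (riesz \<bullet> h)"
    using hform_cnj[OF riesz_carrier riesz_carrier] hform_riesz by metis
  also have "\<dots> = conjugate riesz \<bullet> conjugate h"
    using conjugate_sprod_vec[OF riesz_carrier h(1)] by simp
  also have "\<dots> = conjugate h \<bullet> conjugate riesz"
    using riesz_carrier h by (intro comm_scalar_prod[of _ n]) auto
  finally show ?thesis using conjugate_mat_inv[OF h(1)] by (simp add: riesz_def)
qed

text \<open>Brings the gain into Cauchy-Schwarz form and shows that it is real, so that the order on
  complex numbers reduces to the one on reals.\<close>

lemma power_gain_riesz:
  assumes w: "w \<in> carrier_vec n"
  shows "power_gain A h w = of_real ((cmod (hform A w riesz))\<^sup>2 / Re (hform A w w))"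
proof -
  have "conjugate h \<bullet> conjugate w = conjugate w \<bullet> conjugate h"
    using w h by (intro comm_scalar_prod[of _ n]) auto
  also have "\<dots> = cnj (w \<bullet> h)"
    using conjugate_sprod_vec[OF w h(1)] by simp
  finally have "power_gain A h w =
      hform A w riesz * cnj (hform A w riesz) / hform A w w"
    by (simp add: power_gain_def hform_riesz) (simp add: hform_def)
  also have "\<dots> = of_real ((cmod (hform A w riesz))\<^sup>2 / Re (hform A w w))"
    unfolding of_real_divide complex_norm_square hform_self[OF w, symmetric] ..
  finally show ?thesis .
qed

text \<open>The factor \<open>(cmod c)\<^sup>2\<close> cancels. The common value is the
  Cauchy-Schwarz bound on the gain.\<close>

lemma power_gain_smult_riesz:
  assumes "c \<noteq> 0"
  shows "power_gain A h (c \<cdot>\<^sub>v riesz) = hform A riesz riesz"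
proof -
  define q where "q = Re (hform A riesz riesz)"
  have q: "hform A riesz riesz = of_real q" "q > 0"
    using hform_self[OF riesz_carrier] pos[OF riesz_carrier riesz_nonzero] by (auto simp: q_def)
  have 1: "hform A (c \<cdot>\<^sub>v riesz) riesz = c * of_real q"
    and 2: "hform A (c \<cdot>\<^sub>v riesz) (c \<cdot>\<^sub>v riesz) = of_real ((cmod c)\<^sup>2 * q)"
    using riesz_carrier unfolding of_real_mult complex_norm_square
    by (simp_all add: hform_smult hform_smult_right q)
  show ?thesis
    unfolding q(1) using riesz_carrier q assms
    by (simp add: power_gain_riesz 1 2 norm_mult power_mult_distrib)
      (simp add: power2_eq_square)
qed

lemma maximizes_power_gain_iff:
  "maximizes_power_gain n A h w \<longleftrightarrow> (\<exists>c. c \<noteq> 0 \<and> w = c \<cdot>\<^sub>v riesz)"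
proof
  assume max: "maximizes_power_gain n A h w"
  then have w: "w \<in> carrier_vec n" "w \<noteq> 0\<^sub>v n"
    by (auto simp: maximizes_power_gain_def)
  \<comment> \<open>The representative itself, written as a multiple, is the competitor: a maximizer
    must reach the bound too, hence falls under the equality case.\<close>
  have "power_gain A h (1 \<cdot>\<^sub>v riesz) \<le> power_gain A h w"
    using max riesz_carrier riesz_nonzero by (auto simp: maximizes_power_gain_def)
  then have "Re (hform A riesz riesz) \<le> (cmod (hform A w riesz))\<^sup>2 / Re (hform A w w)"
    unfolding power_gain_smult_riesz[OF one_neq_zero] power_gain_riesz[OF w(1)]
    by (simp add: less_eq_complex_def)
  then obtain c where c: "w = c \<cdot>\<^sub>v riesz"
    using hform_Cauchy_Schwarz[OF w riesz_carrier riesz_nonzero] by (meson order_antisym)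
  moreover have "c \<noteq> 0" using c w riesz_carrier by auto
  ultimately show "\<exists>c. c \<noteq> 0 \<and> w = c \<cdot>\<^sub>v riesz" by blast
next
  assume "\<exists>c. c \<noteq> 0 \<and> w = c \<cdot>\<^sub>v riesz"
  then obtain c where c: "c \<noteq> 0" "w = c \<cdot>\<^sub>v riesz" by blast
  have "w \<noteq> 0\<^sub>v n"
    using c riesz_nonzero riesz_carrier by (auto simp: vec_eq_iff)
  moreover have "power_gain A h v \<le> power_gain A h w"
    if v: "v \<in> carrier_vec n" "v \<noteq> 0\<^sub>v n" for v
    unfolding c(2) power_gain_smult_riesz[OF c(1)] power_gain_riesz[OF v(1)]
    using hform_Cauchy_Schwarz(1)[OF v riesz_carrier riesz_nonzero]
    by (subst hform_self[OF riesz_carrier]) (simp add: less_eq_complex_def)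
  ultimately show "maximizes_power_gain n A h w"
    using c riesz_carrier by (auto simp: maximizes_power_gain_def)
qed

end

text \<open>\<open>mat_inv\<close> is computed by elimination, so its value on the scaled matrix is
  found by uniqueness: a left inverse \<open>C\<close> and a right inverse \<open>?B\<close>
  agree.\<close>

lemma mat_inv_smult:
  assumes "R \<noteq> 0"
  shows "mat_inv (R \<cdot>\<^sub>m A) = (1 / R) \<cdot>\<^sub>m mat_inv A"
proof -
  let ?B = "(1 / R) \<cdot>\<^sub>m mat_inv A"
  have B: "?B \<in> carrier_mat n n" and RA: "R \<cdot>\<^sub>m A \<in> carrier_mat n n"
    using mat_inv_carrier carrier by auto
  have cancel: "R \<cdot>\<^sub>m ((1 / R) \<cdot>\<^sub>m C) = C" "(1 / R) \<cdot>\<^sub>m (R \<cdot>\<^sub>m C) = C" for C :: "real mat"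
    using assms by (auto intro!: eq_matI)
  have inv: "(R \<cdot>\<^sub>m A) * ?B = 1\<^sub>m n" "?B * (R \<cdot>\<^sub>m A) = 1\<^sub>m n"
    using mat_inv carrier assms cancel
    by (simp_all add: mult_smult_distrib[of _ n n] mult_smult_assoc_mat[of _ n n])
  have "R \<cdot>\<^sub>m A \<in> Units (ring_mat TYPE(real) n ())"
    using inv B RA by (auto simp: Units_def ring_mat_def)
  then obtain C where C: "mat_inverse (R \<cdot>\<^sub>m A) = Some C"
    using mat_inverse(1)[OF RA, of "()"] by (cases "mat_inverse (R \<cdot>\<^sub>m A)") auto
  note C' = mat_inverse(2)[OF RA C]
  have "C = C * ((R \<cdot>\<^sub>m A) * ?B)" using inv C' right_mult_one_mat[of C n n] by simp
  also have "\<dots> = (C * (R \<cdot>\<^sub>m A)) * ?B"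
    using assoc_mult_mat[of C n n "R \<cdot>\<^sub>m A" n ?B n] C' RA B by simp
  also have "\<dots> = ?B" using C' B left_mult_one_mat[of ?B n n] by simp
  finally show ?thesis using C by (simp add: mat_inv_def)
qed

end

section \<open>Positive definiteness of the impedance matrix\<close>

text \<open>\<open>G\<close> is nondecreasing, yet does not grow from \<open>a\<close> to
  \<open>b\<close>, so it is constant in between. This stands in for the vanishing of a nonnegative
  integrand with zero integral.\<close>

lemma nonneg_deriv_nonpos_increment_imp_zero:
  fixes G g :: "real \<Rightarrow> real"
  assumes der: "\<And>t. (G has_real_derivative g t) (at t)"
    and ge: "\<And>t. 0 \<le> g t" and le: "G b \<le> G a" and t: "a < t" "t < b"
  shows "g t = 0"
proof -
  have mono: "G x \<le> G y" if "x \<le> y" for x y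
    using DERIV_nonneg_imp_nondecreasing[OF that] der ge by blast
  have const: "G s = G a" if "a < s" "s < b" for s
    using mono[of a s] mono[of s b] le that by simp
  have "((\<lambda>_. G a) has_real_derivative g t) (at t)"
    by (rule has_field_derivative_transform_within_open[OF der, where S = "{a<..<b}"])
      (use t const in auto)
  then show ?thesis
    using DERIV_const DERIV_unique by blast
qed

text \<open>The sum is a polynomial in \<open>cis (a * t)\<close>; these points are infinitely many,
  so the polynomial is zero.\<close>

lemma exp_sum_zero_imp_coeff_zero:
  fixes w :: "nat \<Rightarrow> complex"
  assumes a: "0 < a" "a < pi"
    and zero: "\<And>t. 0 < t \<Longrightarrow> t < 1 \<Longrightarrow> (\<Sum>m<n. w m * cis (a * t) ^ m) = 0"
    and "m < n"
  shows "w m = 0"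
proof -
  define p where "p = (\<Sum>m<n. monom (w m) m)"
  have "inj_on (\<lambda>t. cis (a * t)) {0<..<1::real}"
  proof (rule inj_onI)
    fix s t :: real assume st: "s \<in> {0<..<1}" "t \<in> {0<..<1}" "cis (a * s) = cis (a * t)"
    have rng: "0 \<le> a * x \<and> a * x \<le> pi" if "x \<in> {0<..<1}" for x
    proof -
      have "a * x \<le> a" using that a by simp
      moreover have "0 \<le> a * x" using that a by simp
      ultimately show ?thesis using a by linarith
    qed
    \<comment> \<open>Real parts suffice, since cosine is injective on the interval from 0 to
      \<open>pi\<close>, where both angles lie.\<close>
    have "cos (a * s) = cos (a * t)" using st(3) by (metis cis.sel(1))
    then have "a * s = a * t" using cos_inj_pi rng st by blast
    then show "s = t" using a by simp
  qed
  then have "infinite ((\<lambda>t. cis (a * t)) ` {0<..<1::real})"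
    by (simp add: finite_image_iff)
  moreover have "(\<lambda>t. cis (a * t)) ` {0<..<1::real} \<subseteq> {z. poly p z = 0}"
    using zero by (auto simp: p_def poly_sum poly_monom)
  ultimately have "infinite {z. poly p z = 0}" using finite_subset by blast
  then have "p = 0" using poly_roots_finite by blast
  then have "coeff p m = 0" by simp
  then show ?thesis using \<open>m < n\<close> by (simp add: p_def coeff_sum)
qed

lemma sinc_minus: "y = - x \<Longrightarrow> sin x / x = sin y / y" for x y :: real
  by simp

lemma posdef_impedance_mat:
  assumes d: "0 < d" "d < lam / 2"
  shows "posdef_mat M (impedance_mat M d lam)"
proof
  let ?Z = "impedance_mat M d lam"
  define a where "a = wavenumber lam * d"
  \<comment> \<open>The spacing below half a wavelength is exactly what keeps \<open>a\<close> below
    \<open>pi\<close>.\<close>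
  have a: "0 < a" "a < pi"
    using d by (auto simp: a_def wavenumber_def field_simps)
  show Z: "?Z \<in> carrier_mat M M" by (simp add: impedance_mat_def)
  show "transpose_mat ?Z = ?Z"
  proof (rule eq_matI)
    fix i j assume "i < dim_row ?Z" "j < dim_col ?Z"
    moreover have "sin (a * (real i - real j)) / (a * (real i - real j)) =
        sin (a * (real j - real i)) / (a * (real j - real i))"
      by (rule sinc_minus) (simp add: algebra_simps)
    ultimately show "transpose_mat ?Z $$ (i, j) = ?Z $$ (i, j)"
      by (auto simp: impedance_mat_def a_def)
  qed (auto simp: impedance_mat_def)
  fix w :: "complex vec" assume w: "w \<in> carrier_vec M" "w \<noteq> 0\<^sub>v M"
  define c where "c m n = a * (real m - real n)" for m n :: nat
  define u where "u m n = w $ m * cnj (w $ n)" for m n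
  \<comment> \<open>The summands of \<open>G\<close> are antiderivatives of \<open>Re (u m n * cis (c m n * t))\<close>.\<close>
  define G where "G t = (\<Sum>m<M. \<Sum>n<M. if m = n then Re (u m n) * t
      else (Re (u m n) * sin (c m n * t) + Im (u m n) * cos (c m n * t)) / c m n)" for t
  define f where "f t = (\<Sum>m<M. w $ m * cis (a * t) ^ m)" for t
  have c0: "c m n \<noteq> 0" if "m \<noteq> n" for m n
    using that a by (simp add: c_def)
  have f2: "(cmod (f t))\<^sup>2 = (\<Sum>m<M. \<Sum>n<M. Re (u m n * cis (c m n * t)))" for t
  proof -
    have "(cmod (f t))\<^sup>2 = Re (f t * cnj (f t))"
      by (metis Re_complex_of_real complex_norm_square)
    also have "f t * cnj (f t) = (\<Sum>m<M. \<Sum>n<M. u m n * cis (c m n * t))"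
      unfolding f_def cnj_sum sum_product
    proof (intro sum.cong refl)
      fix m n
      have "cis (a * t) ^ m * cnj (cis (a * t) ^ n) = cis (c m n * t)"
        by (simp add: DeMoivre cis_cnj cis_mult c_def algebra_simps)
      then show "w $ m * cis (a * t) ^ m * cnj (w $ n * cis (a * t) ^ n) = u m n * cis (c m n * t)"
        by (simp add: u_def mult_ac)
    qed
    finally show ?thesis by simp
  qed
  have der: "(G has_real_derivative (cmod (f t))\<^sup>2) (at t)" for t
    unfolding G_def f2
  proof (intro DERIV_sum)
    fix m n
    show "((\<lambda>t. if m = n then Re (u m n) * t
        else (Re (u m n) * sin (c m n * t) + Im (u m n) * cos (c m n * t)) / c m n)
        has_real_derivative Re (u m n * cis (c m n * t))) (at t)"
    proof (cases "m = n")
      \<comment> \<open>Here \<open>c m n\<close> is 0 and \<open>cis\<close> is 1, so the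
        antiderivative is linear in \<open>t\<close>.\<close>
      case True
      then show ?thesis by (auto simp: c_def intro!: derivative_eq_intros)
    next
      case False
      then show ?thesis using c0[OF False]
        by (auto intro!: derivative_eq_intros simp: field_simps)
    qed
  qed
  \<comment> \<open>Between -1 and 1 the even cosine terms cancel and the odd sine terms double,
    leaving \<open>2 * sin (c m n) / c m n\<close> off the diagonal and 2 on it, twice the entry of
    the matrix.\<close>
  have inc: "G 1 - G (-1) = 2 * Re (hform ?Z w w)"
    unfolding hform_sum[OF Z w(1,1)] G_def sum_subtractf[symmetric] Re_sum sum_distrib_left
  proof (intro sum.cong refl)
    fix m n assume "m \<in> {..<M}" "n \<in> {..<M}"
    moreover have "sin (a * (real n - real m)) / (a * (real n - real m)) = sin (c m n) / c m n"
      by (rule sinc_minus) (simp add: c_def algebra_simps)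
    ultimately have Zmn: "?Z $$ (m, n) = (if m = n then 1 else sin (c m n) / c m n)"
      by (simp add: impedance_mat_def a_def)
    have "2 * Re (w $ m * (of_real (?Z $$ (m, n)) * cnj (w $ n))) =
        2 * ?Z $$ (m, n) * Re (u m n)"
      by (simp add: u_def algebra_simps)
    then show "(if m = n then Re (u m n) * 1
        else (Re (u m n) * sin (c m n * 1) + Im (u m n) * cos (c m n * 1)) / c m n) -
      (if m = n then Re (u m n) * - 1
        else (Re (u m n) * sin (c m n * - 1) + Im (u m n) * cos (c m n * - 1)) / c m n) =
      2 * Re (w $ m * (of_real (?Z $$ (m, n)) * cnj (w $ n)))"
      using c0[of m n] by (auto simp: Zmn field_simps)
  qed
  show "0 < Re (hform ?Z w w)"
  proof (rule ccontr)
    assume "\<not> 0 < Re (hform ?Z w w)"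
    then have "G 1 \<le> G (-1)" using inc by simp
    then have "(cmod (f t))\<^sup>2 = 0" if "0 < t" "t < 1" for t
      using nonneg_deriv_nonpos_increment_imp_zero[OF der, of 1 "-1" t] that by simp
    \<comment> \<open>Half of the interval is enough, and there the angles \<open>a * t\<close> stay
      between 0 and \<open>pi\<close>.\<close>
    then have "(\<Sum>m<M. w $ m * cis (a * t) ^ m) = 0" if "0 < t" "t < 1" for t
      using that by (simp add: f_def)
    then have "w $ m = 0" if "m < M" for m
      using exp_sum_zero_imp_coeff_zero[OF a, where n = M and w = "\<lambda>m. w $ m"] that by blast
    then show False using w by (auto simp: vec_eq_iff)
  qed
qed

section \<open>Power normalisation\<close>

text \<open>On nonnegative reals \<open>csqrt\<close> is the real square root, and the sign
  condition on \<gamma> singles out one of the two roots.\<close>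

lemma square_eq_iff_eq_csqrt:
  assumes "0 \<le> \<gamma>" "0 \<le> x"
  shows "\<gamma>\<^sup>2 = x \<longleftrightarrow> complex_of_real \<gamma> = csqrt (of_real x)"
  using assms by (auto simp: of_real_sqrt[symmetric] real_sqrt_unique)

theorem lemma1:
  fixes M P :: nat and d lam R_rad \<rho> :: real
    and \<alpha> :: "'u \<Rightarrow> nat \<Rightarrow> complex" and \<phi> :: "'u \<Rightarrow> nat \<Rightarrow> real" and u :: 'u
    and Z :: "real mat" and h :: "'u \<Rightarrow> complex vec"
  assumes "M \<ge> 1" and "P \<ge> 1"
    and "0 < d" and "d < lam / 2"
    and "R_rad > 0" and "\<rho> \<ge> 0"
    and Z: "Z = impedance_mat M d lam"
    and h: "\<And>v. h v = channel_vec M d lam P (\<alpha> v) (\<phi> v)"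
    and "h u \<noteq> 0\<^sub>v M"
  shows "invertible_mat Z \<and>
    (\<forall>w. maximizes_power_gain M Z (h u) w \<longleftrightarrow> (\<exists>\<gamma>. \<gamma> \<noteq> 0 \<and> w = sp_precoder Z (h u) \<gamma>)) \<and>
    (\<forall>\<gamma>\<ge>0. radiated_power R_rad Z (sp_precoder (R_rad \<cdot>\<^sub>m Z) (h u) (complex_of_real \<gamma>)) = complex_of_real \<rho>
       \<longleftrightarrow> complex_of_real \<gamma> = power_coeff R_rad Z (h u) \<rho>) \<and>
    (\<forall>\<gamma>\<ge>0. radiated_power R_rad Z (sp_precoder Z (h u) (complex_of_real \<gamma>)) = complex_of_real \<rho>
       \<longleftrightarrow> complex_of_real \<gamma> = power_coeff R_rad Z (h u) \<rho> / complex_of_real R_rad)"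
proof -
  interpret posdef_mat M Z
    unfolding Z using assms(3,4) by (rule posdef_impedance_mat)
  let ?R = R_rad
  have hu: "h u \<in> carrier_vec M" "h u \<noteq> 0\<^sub>v M"
    using h[of u] \<open>h u \<noteq> 0\<^sub>v M\<close> by (auto simp: channel_vec_def)
  define g where "g = riesz (h u)"
  have g: "g \<in> carrier_vec M" unfolding g_def by (rule riesz_carrier[OF hu])
  define q where "q = Re (hform Z g g)"
  have q: "hform Z g g = of_real q" "q > 0"
    using hform_self[OF g] pos[OF g] riesz_nonzero[OF hu] by (auto simp: q_def g_def)
  have sp: "sp_precoder Z (h u) \<gamma> = \<gamma> \<cdot>\<^sub>v g" for \<gamma>
    by (simp add: sp_precoder_def g_def riesz_def[OF hu])
  have cinv: "cmat (mat_inv (?R \<cdot>\<^sub>m Z)) *\<^sub>v x = of_real (1 / ?R) \<cdot>\<^sub>v (cmat (mat_inv Z) *\<^sub>v x)"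
    if "x \<in> carrier_vec M" for x
    using mat_inv_smult[of ?R] \<open>?R > 0\<close> mat_inv_carrier that
    by (intro eq_vecI) (auto simp: scalar_prod_def sum_divide_distrib)
  \<comment> \<open>Scaling the matrix by \<open>?R\<close> divides the precoder by
    \<open>?R\<close>, so both normalisations concern multiples of the same
    \<open>g\<close>.\<close>
  have spR: "sp_precoder (?R \<cdot>\<^sub>m Z) (h u) (of_real \<gamma>) = sp_precoder Z (h u) (of_real (\<gamma> / ?R))" for \<gamma>
    using hu cinv[of "conjugate (h u)"] by (simp add: sp_precoder_def smult_smult_assoc)
  have rad: "radiated_power ?R Z (of_real \<gamma> \<cdot>\<^sub>v g) = of_real (?R * \<gamma>\<^sup>2 * q / 2)" for \<gamma>
  proof -
    let ?w = "complex_of_real \<gamma> \<cdot>\<^sub>v g"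
    have w: "?w \<in> carrier_vec M" using g by simp
    have "cmat (?R \<cdot>\<^sub>m Z) *\<^sub>v conjugate ?w = of_real ?R \<cdot>\<^sub>v (cmat Z *\<^sub>v conjugate ?w)"
      using w carrier
      by (intro eq_vecI) (auto simp: scalar_prod_def sum_distrib_left mult.assoc)
    moreover have "cmat Z *\<^sub>v conjugate ?w \<in> carrier_vec M"
      using w by (intro mult_mat_vec_carrier[OF cmat_carrier]) simp
    ultimately have "radiated_power ?R Z ?w = 1 / 2 * (of_real ?R * hform Z ?w ?w)"
      using w by (simp add: radiated_power_def hform_def)
    then show ?thesis
      using g q by (simp add: hform_smult hform_smult_right power2_eq_square)
  qed
  \<comment> \<open>The denominator under the root of \<open>power_coeff\<close>.\<close>
  have "conjugate (h u) \<bullet> (cmat (mat_inv (?R \<cdot>\<^sub>m Z)) *\<^sub>v h u) = of_real (q / ?R)"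
  proof -
    have "conjugate (h u) \<bullet> (cmat (mat_inv Z) *\<^sub>v h u) = of_real q"
      using q hform_riesz_self[OF hu] by (simp add: g_def)
    moreover have "cmat (mat_inv Z) *\<^sub>v h u \<in> carrier_vec M"
      using mat_inv_carrier hu by (intro mult_mat_vec_carrier[of _ M M]) auto
    ultimately show ?thesis
      using hu cinv[of "h u"]
        scalar_prod_smult_distrib[of "conjugate (h u)" M "cmat (mat_inv Z) *\<^sub>v h u" "of_real (1 / ?R)"]
      by simp
  qed
  then have coeff: "power_coeff ?R Z (h u) \<rho> = csqrt (of_real (2 * \<rho> * ?R / q))"
    by (simp add: power_coeff_def)
  have x: "0 \<le> 2 * \<rho> * ?R / q" using q assms(5,6) by simp
  \<comment> \<open>By \<open>rad\<close>, the coefficient \<open>\<gamma> / ?R\<close> radiates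
    \<open>\<gamma>\<^sup>2 * q / (2 * ?R)\<close>; equating this to \<rho> gives the radicand in
    \<open>coeff\<close>.\<close>
  have third: "radiated_power ?R Z (of_real (\<gamma> / ?R) \<cdot>\<^sub>v g) = of_real \<rho>
      \<longleftrightarrow> of_real \<gamma> = power_coeff ?R Z (h u) \<rho>" if "\<gamma> \<ge> 0" for \<gamma>
  proof -
    have "radiated_power ?R Z (of_real (\<gamma> / ?R) \<cdot>\<^sub>v g) = of_real \<rho> \<longleftrightarrow> \<gamma>\<^sup>2 = 2 * \<rho> * ?R / q"
      unfolding rad of_real_eq_iff using q \<open>?R > 0\<close>
      by (auto simp: field_simps power2_eq_square)
    then show ?thesis unfolding coeff square_eq_iff_eq_csqrt[OF that x] .
  qed
  \<comment> \<open>The previous equivalence at \<open>?R * \<gamma>\<close>, where the two factors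
    \<open>?R\<close> cancel.\<close>
  have "radiated_power ?R Z (of_real \<gamma> \<cdot>\<^sub>v g) = of_real \<rho>
      \<longleftrightarrow> of_real \<gamma> = power_coeff ?R Z (h u) \<rho> / of_real ?R" if "\<gamma> \<ge> 0" for \<gamma>
    using third[of "?R * \<gamma>"] that \<open>?R > 0\<close> by (auto simp: field_simps)
  then show ?thesis
    using invertible maximizes_power_gain_iff[OF hu] third spR
    by (simp add: sp g_def[symmetric])
qed

end
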